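(* Every data language recognized by a data deterministic session automaton is recognized by a session automaton, and there exists a data language recognized by a session automaton (namely the set of all $2$-bounded data words over $\Sigma$) that is not recognized by any data deterministic session automaton. Hence session automata are strictly more expressive than data deterministic session automata.
   Context: $\Sigma$ is a non-empty finite alphabet, $D$ an infinite set of data values; data words are elements of $(\Sigma\times D)^*$. A session automaton is a tuple $\mathcal A=(S,\mathcal R,\iota,F,\Delta)$ with $S$ a non-empty finite set of states, $\mathcal R$ a non-empty finite set of registers, $\iota\in S$, $F\subseteq S$, and $\Delta$ a finite set of transitions $(s,(a,\pi),s')$ with $a\in\Sigma$ and $\pi\in\{r^\circledast,r^\uparrow: r\in\mathcal R\}$. Configurations are $(s,\tau,U)$ with $\tau:\mathcal R\rightharpoonup D$ partial and $U\subseteq D$. Reading $(a,d)$, a transition $(s,(a,\pi),s')$ on register $r$ can be taken if $d=\tau(r)$ (when $\pi=r^\uparrow$) or $d\notin U$ (when $\pi=r^\circledast$, global freshness); then $\tau$ is updated by $\tau(r):=d$, $U:=U\cup\{d\}$, and the state becomes $s'$. Runs start in $(\iota,\emptyset,\emptyset)$; a data word is accepted if some run on it ends in a state of $F$; $L(\mathcal A)$ is the set of accepted data words. $\mathcal A$ is symbolically deterministic if for all $s,a,\pi$ there is at most one $s'$ with $(s,(a,\pi),s')\in\Delta$; it is data deterministic if it is symbolically deterministic and for all $s\in S$, $a\in\Sigma$ and distinct $r_1,r_2\in\mathcal R$, not both $(s,(a,r_1^\circledast))$ and $(s,(a,r_2^\circledast))$ have outgoing transitions. For a data word $w=(a_1,d_1)\cdots(a_n,d_n)$,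 a session is a set $\{\mathrm{first}_w(d),\dots,\mathrm{last}_w(d)\}$ for a data value $d$ occurring in $w$, where $\mathrm{first}_w(d)$, $\mathrm{last}_w(d)$ are the first and last positions carrying $d$; $w$ is $k$-bounded if every position is contained in at most $k$ sessions. *)

theory Defs
  imports Main
begin

text \<open>The finite non-empty alphabet is a type \<open>'a::finite\<close>; the set of data values is a type \<open>'d\<close>,
  assumed infinite where that matters.\<close>

type_synonym ('a, 'd) data_word = "('a \<times> 'd) list"

type_synonym ('a, 'd) data_language = "('a, 'd) data_word set"

datatype 'r action = Fresh 'r | Reuse 'r

fun reg :: "'r action \<Rightarrow> 'r" where
  "reg (Fresh r) = r"
| "reg (Reuse r) = r"

record ('s, 'r, 'a) automaton =
  states :: "'s set"
  registers :: "'r set"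
  initial :: 's
  final :: "'s set"
  transitions :: "('s \<times> ('a \<times> 'r action) \<times> 's) set"

definition session_automaton :: "('s, 'r, 'a::finite) automaton \<Rightarrow> bool" where
  "session_automaton A \<longleftrightarrow>
     finite (states A) \<and> states A \<noteq> {} \<and>
     finite (registers A) \<and> registers A \<noteq> {} \<and>
     initial A \<in> states A \<and> final A \<subseteq> states A \<and>
     finite (transitions A) \<and>
     (\<forall>(s, (a, \<pi>), s') \<in> transitions A. s \<in> states A \<and> s' \<in> states A \<and> reg \<pi> \<in> registers A)"

type_synonym ('s, 'r, 'd) config = "'s \<times> ('r \<rightharpoonup> 'd) \<times> 'd set"

fun enabled :: "('r \<rightharpoonup> 'd) \<Rightarrow> 'd set \<Rightarrow> 'r action \<Rightarrow> 'd \<Rightarrow> bool" where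
  "enabled \<tau> U (Fresh r) d \<longleftrightarrow> d \<notin> U"
| "enabled \<tau> U (Reuse r) d \<longleftrightarrow> \<tau> r = Some d"

inductive run ::
  "('s, 'r, 'a) automaton \<Rightarrow> ('s, 'r, 'd) config \<Rightarrow> ('a, 'd) data_word \<Rightarrow> ('s, 'r, 'd) config \<Rightarrow> bool"
  for A where
  run_Nil: "run A c [] c"
| run_Cons: "(s, (a, \<pi>), s') \<in> transitions A \<Longrightarrow> enabled \<tau> U \<pi> d \<Longrightarrow>
    run A (s', \<tau>(reg \<pi> \<mapsto> d), insert d U) w c \<Longrightarrow>
    run A (s, \<tau>, U) ((a, d) # w) c"

definition language :: "('s, 'r, 'a) automaton \<Rightarrow> ('a, 'd) data_language" where
  "language A = {w. \<exists>s \<tau> U. run A (initial A, Map.empty, {}) w (s, \<tau>, U) \<and> s \<in> final A}"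

definition symbolically_deterministic :: "('s, 'r, 'a) automaton \<Rightarrow> bool" where
  "symbolically_deterministic A \<longleftrightarrow>
     (\<forall>s a \<pi> s' s''. (s, (a, \<pi>), s') \<in> transitions A \<longrightarrow> (s, (a, \<pi>), s'') \<in> transitions A \<longrightarrow> s' = s'')"

definition data_deterministic :: "('s, 'r, 'a) automaton \<Rightarrow> bool" where
  "data_deterministic A \<longleftrightarrow>
     symbolically_deterministic A \<and>
     (\<forall>s \<in> states A. \<forall>a. \<forall>r1 \<in> registers A. \<forall>r2 \<in> registers A. r1 \<noteq> r2 \<longrightarrow>
        \<not> ((\<exists>s'. (s, (a, Fresh r1), s') \<in> transitions A) \<and>
           (\<exists>s'. (s, (a, Fresh r2), s') \<in> transitions A)))"

text \<open>HOL cannot quantify over the types of states and registers inside a definition. As both sets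
  are finite, natural numbers can be used as names; the lemmas \<open>sa_recognizableI\<close> and
  \<open>dsa_recognizableI\<close> below show that no language is lost by this.\<close>

definition sa_recognizable :: "('a::finite, 'd) data_language \<Rightarrow> bool" where
  "sa_recognizable L \<longleftrightarrow>
     (\<exists>A :: (nat, nat, 'a) automaton. session_automaton A \<and> language A = L)"

definition dsa_recognizable :: "('a::finite, 'd) data_language \<Rightarrow> bool" where
  "dsa_recognizable L \<longleftrightarrow>
     (\<exists>A :: (nat, nat, 'a) automaton. session_automaton A \<and> data_deterministic A \<and> language A = L)"

text \<open>Positions of a word are counted from 0.\<close>

definition positions :: "('a, 'd) data_word \<Rightarrow> 'd \<Rightarrow> nat set" where
  "positions w d = {i. i < length w \<and> snd (w ! i) = d}"

definition first_pos :: "('a, 'd) data_word \<Rightarrow> 'd \<Rightarrow> nat" where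
  "first_pos w d = Min (positions w d)"

definition last_pos :: "('a, 'd) data_word \<Rightarrow> 'd \<Rightarrow> nat" where
  "last_pos w d = Max (positions w d)"

definition sessions :: "('a, 'd) data_word \<Rightarrow> nat set set" where
  "sessions w = {{first_pos w d..last_pos w d} | d. d \<in> snd ` set w}"

definition bounded :: "nat \<Rightarrow> ('a, 'd) data_word \<Rightarrow> bool" where
  "bounded k w \<longleftrightarrow> (\<forall>i < length w. card {I \<in> sessions w. i \<in> I} \<le> k)"

fun rename_action :: "('r \<Rightarrow> 'q) \<Rightarrow> 'r action \<Rightarrow> 'q action" where
  "rename_action g (Fresh r) = Fresh (g r)"
| "rename_action g (Reuse r) = Reuse (g r)"

definition rename :: "('s \<Rightarrow> 't) \<Rightarrow> ('r \<Rightarrow> 'q) \<Rightarrow> ('s, 'r, 'a) automaton \<Rightarrow> ('t, 'q, 'a) automaton" where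
  "rename f g A =
     \<lparr>states = f ` states A, registers = g ` registers A, initial = f (initial A),
      final = f ` final A,
      transitions = (\<lambda>(s, (a, \<pi>), s'). (f s, (a, rename_action g \<pi>), f s')) ` transitions A\<rparr>"

lemma reg_rename_action [simp]: "reg (rename_action g \<pi>) = g (reg \<pi>)"
  by (cases \<pi>) auto

lemma session_automatonD:
  assumes "session_automaton A" "(s, (a, \<pi>), s') \<in> transitions A"
  shows "s \<in> states A" "s' \<in> states A" "reg \<pi> \<in> registers A"
  using assms unfolding session_automaton_def by fast+

lemma session_automaton_rename:
  assumes "session_automaton A"
  shows "session_automaton (rename f g A)"
  using assms unfolding session_automaton_def rename_def by fastforce

lemma rename_action_eqD:
  assumes "inj_on g R" "reg \<pi> \<in> R" "reg \<rho> \<in> R" "rename_action g \<pi> = rename_action g \<rho>"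
  shows "\<pi> = \<rho>"
  using assms by (cases \<pi>; cases \<rho>) (auto dest: inj_onD)

lemma rename_transitionE:
  assumes "(t, (a, \<rho>), t') \<in> transitions (rename f g A)"
  obtains s \<pi> s' where "(s, (a, \<pi>), s') \<in> transitions A" "t = f s" "t' = f s'"
    "\<rho> = rename_action g \<pi>"
  using assms unfolding rename_def by fastforce

lemma data_deterministic_rename:
  assumes A: "session_automaton A" "data_deterministic A"
    and f: "inj_on f (states A)" and g: "inj_on g (registers A)"
  shows "data_deterministic (rename f g A)"
proof -
  have sym: "s' = s''"
    if "(s, (a, \<pi>), s') \<in> transitions A" "(s, (a, \<pi>), s'') \<in> transitions A" for s a \<pi> s' s''
    using A(2) that unfolding data_deterministic_def symbolically_deterministic_def by blast
  have fresh: "r1 = r2"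
    if "(s, (a, Fresh r1), s') \<in> transitions A" "(s, (a, Fresh r2), s'') \<in> transitions A"
    for s a r1 r2 s' s''
  proof -
    have "s \<in> states A" "r1 \<in> registers A" "r2 \<in> registers A"
      using session_automatonD[OF A(1) that(1)] session_automatonD[OF A(1) that(2)] by auto
    then show ?thesis
      using A(2) that unfolding data_deterministic_def by blast
  qed
  have "symbolically_deterministic (rename f g A)"
    unfolding symbolically_deterministic_def
  proof (intro allI impI)
    fix t a \<rho> t' t''
    assume 1: "(t, (a, \<rho>), t') \<in> transitions (rename f g A)"
      and 2: "(t, (a, \<rho>), t'') \<in> transitions (rename f g A)"
    from 1 obtain s1 p1 s1' where e1: "(s1, (a, p1), s1') \<in> transitions A" "t = f s1" "t' = f s1'"
      "\<rho> = rename_action g p1" by (rule rename_transitionE)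
    from 2 obtain s2 p2 s2' where e2: "(s2, (a, p2), s2') \<in> transitions A" "t = f s2" "t'' = f s2'"
      "\<rho> = rename_action g p2" by (rule rename_transitionE)
    have "s1 = s2"
      using f e1(2) e2(2) session_automatonD(1)[OF A(1) e1(1)] session_automatonD(1)[OF A(1) e2(1)]
      by (auto dest: inj_onD)
    moreover have "p1 = p2"
      using rename_action_eqD[OF g session_automatonD(3)[OF A(1) e1(1)]
          session_automatonD(3)[OF A(1) e2(1)]] e1(4) e2(4) by simp
    ultimately show "t' = t''" using sym e1 e2 by blast
  qed
  moreover have "q1 = q2"
    if 1: "(t, (a, Fresh q1), t') \<in> transitions (rename f g A)"
      and 2: "(t, (a, Fresh q2), t'') \<in> transitions (rename f g A)" for t a q1 q2 t' t''
  proof -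
    from 1 obtain s1 p1 s1' where e1: "(s1, (a, p1), s1') \<in> transitions A" "t = f s1"
      "Fresh q1 = rename_action g p1" by (rule rename_transitionE)
    from 2 obtain s2 p2 s2' where e2: "(s2, (a, p2), s2') \<in> transitions A" "t = f s2"
      "Fresh q2 = rename_action g p2" by (rule rename_transitionE)
    have "s1 = s2"
      using f e1(2) e2(2) session_automatonD(1)[OF A(1) e1(1)] session_automatonD(1)[OF A(1) e2(1)]
      by (auto dest: inj_onD)
    moreover obtain r1 where "p1 = Fresh r1" "q1 = g r1" using e1(3) by (cases p1) auto
    moreover obtain r2 where "p2 = Fresh r2" "q2 = g r2" using e2(3) by (cases p2) auto
    ultimately show ?thesis using fresh e1(1) e2(1) by blast
  qed
  ultimately show ?thesis unfolding data_deterministic_def by blast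
qed

lemma run_rename:
  assumes A: "session_automaton A" and g: "inj_on g (registers A)"
    and "run A c w c'"
  shows "(\<forall>r \<in> registers A. \<theta> (g r) = fst (snd c) r) \<Longrightarrow>
    \<exists>\<theta>'. run (rename f g A) (f (fst c), \<theta>, snd (snd c)) w (f (fst c'), \<theta>', snd (snd c'))"
  using assms(3)
proof (induction arbitrary: \<theta> rule: run.induct)
  case (run_Nil c)
  then show ?case by (auto intro: run.run_Nil)
next
  case (run_Cons s a \<pi> s' \<tau> U d w c)
  note r = session_automatonD(3)[OF A run_Cons.hyps(1)]
  have "\<forall>r\<in>registers A. (\<theta>(g (reg \<pi>) \<mapsto> d)) (g r) = (\<tau>(reg \<pi> \<mapsto> d)) r"
    using run_Cons.prems g r by (auto dest: inj_onD)
  then obtain \<theta>' where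
    "run (rename f g A) (f s', \<theta>(g (reg \<pi>) \<mapsto> d), insert d U) w (f (fst c), \<theta>', snd (snd c))"
    using run_Cons.IH by fastforce
  moreover have "(f s, (a, rename_action g \<pi>), f s') \<in> transitions (rename f g A)"
    using run_Cons.hyps(1) unfolding rename_def by force
  moreover have "enabled \<theta> U (rename_action g \<pi>) d"
    using run_Cons.hyps(2) run_Cons.prems r by (cases \<pi>) auto
  ultimately show ?case
    by (auto intro!: exI[of _ \<theta>'] run.run_Cons)
qed

lemma language_rename_subset:
  assumes "session_automaton A" "inj_on g (registers A)"
  shows "language A \<subseteq> language (rename f g A)"
proof
  fix w assume "w \<in> language A"
  then obtain s \<tau> U where "run A (initial A, Map.empty, {}) w (s, \<tau>, U)" "s \<in> final A"
    unfolding language_def by auto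
  with run_rename[OF assms this(1), of Map.empty f] show "w \<in> language (rename f g A)"
    unfolding language_def by (auto simp: rename_def)
qed

lemma rename_inverse:
  assumes A: "session_automaton A" and f: "inj_on f (states A)" and g: "inj_on g (registers A)"
  shows "rename (inv_into (states A) f) (inv_into (registers A) g) (rename f g A) = A"
proof -
  have act: "rename_action (inv_into (registers A) g) (rename_action g \<pi>) = \<pi>"
    if "reg \<pi> \<in> registers A" for \<pi>
    using that g by (cases \<pi>) auto
  have "(\<lambda>x. (\<lambda>(s, (a, \<pi>), s'). (inv_into (states A) f s,
            (a, rename_action (inv_into (registers A) g) \<pi>), inv_into (states A) f s'))
        ((\<lambda>(s, (a, \<pi>), s'). (f s, (a, rename_action g \<pi>), f s')) x)) ` transitions A
      = (\<lambda>x. x) ` transitions A"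
    using session_automatonD[OF A] act f by (intro image_cong) auto
  moreover have "(\<lambda>x. inv_into (states A) f (f x)) ` final A = final A"
    using A f unfolding session_automaton_def by force
  ultimately show ?thesis
    using A f g by (auto simp: rename_def image_image session_automaton_def intro!: automaton.equality)
qed

lemma language_rename:
  assumes A: "session_automaton A" and f: "inj_on f (states A)" and g: "inj_on g (registers A)"
  shows "language (rename f g A) = language A"
proof
  show "language A \<subseteq> language (rename f g A)"
    by (rule language_rename_subset[OF A g])
  have "inj_on (inv_into (registers A) g) (registers (rename f g A))"
    by (simp add: rename_def inj_on_inv_into)
  from language_rename_subset[OF session_automaton_rename[OF A] this]
  show "language (rename f g A) \<subseteq> language A"
    using rename_inverse[OF A f g] by metis
qed

lemma ex_nat_names:
  assumes "session_automaton A"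
  obtains f g :: "_ \<Rightarrow> nat" where "inj_on f (states A)" "inj_on g (registers A)"
  using assms unfolding session_automaton_def by (metis finite_imp_inj_to_nat_seg)

lemma sa_recognizableI:
  fixes A :: "('s, 'r, 'a::finite) automaton"
  assumes "session_automaton A"
  shows "sa_recognizable (language A :: ('a, 'd) data_language)"
  using assms ex_nat_names session_automaton_rename language_rename
  unfolding sa_recognizable_def by metis

lemma dsa_recognizableI:
  fixes A :: "('s, 'r, 'a::finite) automaton"
  assumes "session_automaton A" "data_deterministic A"
  shows "dsa_recognizable (language A :: ('a, 'd) data_language)"
  using assms ex_nat_names session_automaton_rename language_rename data_deterministic_rename
  unfolding dsa_recognizable_def by metis

end

theory Submission
  imports Defs
begin

text \<open>Global freshness means that a value that has been overwritten can never be read again, so the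
  values of all open sessions sit in registers. Hence \<open>k\<close> registers only accept \<open>k\<close>-bounded words, and
  the one-state automaton with \<open>k\<close> registers and all transitions accepts all of them, as a fresh value
  may overwrite a value whose session is closed. A data deterministic automaton reaches only one
  configuration on \<open>d\<^sub>1 \<dots> d\<^sub>n\<close>. Since every \<open>d\<^sub>1 \<dots> d\<^sub>n d\<^sub>i\<close> is 2-bounded, this configuration has to
  store all of \<open>d\<^sub>1, \<dots>, d\<^sub>n\<close>, which is impossible when \<open>n\<close> exceeds the number of registers.\<close>

section \<open>Bounded words\<close>

abbreviation data :: "('a, 'd) data_word \<Rightarrow> 'd set" where
  "data w \<equiv> snd ` set w"

lemma finite_positions: "finite (positions w d)"
  by (simp add: positions_def)

lemma positions_nonempty: "d \<in> data w \<Longrightarrow> positions w d \<noteq> {}"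
  by (fastforce simp: positions_def in_set_conv_nth)

lemma first_pos_le_iff:
  assumes "d \<in> data w"
  shows "first_pos w d \<le> i \<longleftrightarrow> d \<in> data (take (Suc i) w)"
  unfolding first_pos_def Min_le_iff[OF finite_positions positions_nonempty[OF assms]]
  by (force simp: positions_def in_set_conv_nth image_iff)

lemma le_last_pos_iff:
  assumes "d \<in> data w"
  shows "i \<le> last_pos w d \<longleftrightarrow> d \<in> data (drop i w)"
proof -
  have "i \<le> last_pos w d \<longleftrightarrow> (\<exists>j \<in> positions w d. i \<le> j)"
    unfolding last_pos_def by (rule Max_ge_iff[OF finite_positions positions_nonempty[OF assms]])
  also have "\<dots> \<longleftrightarrow> d \<in> data (drop i w)"
  proof
    assume "\<exists>j \<in> positions w d. i \<le> j"
    then obtain j where j: "i \<le> j" "j < length w" "snd (w ! j) = d"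
      by (auto simp: positions_def)
    then have "drop i w ! (j - i) = w ! j" "j - i < length (drop i w)"
      by auto
    with j show "d \<in> data (drop i w)"
      by (metis imageI nth_mem)
  next
    assume "d \<in> data (drop i w)"
    then obtain n where n: "n < length (drop i w)" "snd (drop i w ! n) = d"
      by (metis imageE in_set_conv_nth)
    then have "i + n < length w" "snd (w ! (i + n)) = d"
      by auto
    then show "\<exists>j \<in> positions w d. i \<le> j"
      by (auto simp: positions_def intro!: exI[of _ "i + n"])
  qed
  finally show ?thesis .
qed

text \<open>The left end of a session is a position that carries its value, so the interval
  determines the value.\<close>

lemma inj_on_session: "inj_on (\<lambda>d. {first_pos w d..last_pos w d}) (data w)"
proof (rule inj_onI)
  fix d e
  assume d: "d \<in> data w" and e: "e \<in> data w"
    and eq: "{first_pos w d..last_pos w d} = {first_pos w e..last_pos w e}"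
  have mem: "first_pos w c \<in> positions w c" if "c \<in> data w" for c
    unfolding first_pos_def using that by (intro Min_in finite_positions positions_nonempty)
  have "first_pos w d \<le> last_pos w d"
    unfolding last_pos_def using mem[OF d] by (intro Max_ge finite_positions)
  with eq have "first_pos w d = first_pos w e"
    by (simp add: atLeastatMost_empty_iff Icc_eq_Icc)
  with mem[OF d] mem[OF e] show "d = e"
    by (auto simp: positions_def)
qed

text \<open>A session covers \<open>i\<close> exactly if its value occurs both up to
  \<open>i\<close> and from \<open>i\<close> on, where \<open>i\<close> itself counts on both sides.
  As sessions and values correspond one to one, counting values suffices.\<close>

lemma card_sessions_at:
  "card {I \<in> sessions w. i \<in> I} = card (data (take (Suc i) w) \<inter> data (drop i w))"
proof -
  let ?I = "\<lambda>d. {first_pos w d..last_pos w d}"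
  let ?D = "data (take (Suc i) w) \<inter> data (drop i w)"
  have sub: "?D \<subseteq> data w"
    using set_drop_subset[of i w] by blast
  have "{I \<in> sessions w. i \<in> I} = ?I ` {d \<in> data w. i \<in> ?I d}"
    unfolding sessions_def by auto
  also have "{d \<in> data w. i \<in> ?I d} = ?D"
    using sub first_pos_le_iff[of _ w i] le_last_pos_iff[of _ w i]
    by (simp only: atLeastAtMost_iff) blast
  finally show ?thesis
    using inj_on_subset[OF inj_on_session sub] by (simp add: card_image)
qed

text \<open>Cutting the word at a letter replaces positions by a split that fits induction along
  runs. The letter \<open>x\<close> belongs to both parts because its own session is open
  there.\<close>

lemma bounded_iff_split:
  "bounded k w \<longleftrightarrow>
    (\<forall>u x v. w = u @ x # v \<longrightarrow> card (data (u @ [x]) \<inter> data (x # v)) \<le> k)"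
proof
  assume b: "bounded k w"
  show "\<forall>u x v. w = u @ x # v \<longrightarrow> card (data (u @ [x]) \<inter> data (x # v)) \<le> k"
  proof (intro allI impI)
    fix u x v assume w: "w = u @ x # v"
    have "card (data (take (Suc (length u)) w) \<inter> data (drop (length u) w)) \<le> k"
      using b[unfolded bounded_def card_sessions_at, rule_format, of "length u"] w by simp
    then show "card (data (u @ [x]) \<inter> data (x # v)) \<le> k"
      using w by simp
  qed
next
  assume r: "\<forall>u x v. w = u @ x # v \<longrightarrow> card (data (u @ [x]) \<inter> data (x # v)) \<le> k"
  show "bounded k w"
    unfolding bounded_def card_sessions_at
  proof (intro allI impI)
    fix i assume i: "i < length w"
    show "card (data (take (Suc i) w) \<inter> data (drop i w)) \<le> k"
      using r[rule_format, OF id_take_nth_drop[OF i]] i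
      by (simp only: take_Suc_conv_app_nth Cons_nth_drop_Suc)
  qed
qed

lemma bounded_2_repeat:
  assumes "distinct (map snd w)"
  shows "bounded 2 (w @ [(a, d)])"
  unfolding bounded_iff_split
proof (intro allI impI)
  fix u x v assume eq: "w @ [(a, d)] = u @ x # v"
  have "data (u @ [x]) \<inter> data (x # v) \<subseteq> {snd x, d}"
  \<comment> \<open>If \<open>v\<close> is empty, the right part is the letter \<open>x\<close>
    alone. Otherwise \<open>x\<close> lies within \<open>w\<close>, whose values are distinct, so
    only the appended \<open>d\<close> can link the two sides besides \<open>x\<close>
    itself.\<close>
  proof (cases v rule: rev_cases)
    case Nil
    then show ?thesis by auto
  next
    case (snoc v' y)
    with eq have "w = u @ x # v'" "y = (a, d)" by auto
    with snoc assms show ?thesis by auto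
  qed
  then have "card (data (u @ [x]) \<inter> data (x # v)) \<le> card {snd x, d}"
    by (intro card_mono) auto
  also have "\<dots> \<le> 2"
    by (simp add: card_insert_if)
  finally show "card (data (u @ [x]) \<inter> data (x # v)) \<le> 2" .
qed

section \<open>Runs\<close>

inductive_cases run_NilE: "run A c [] c'"
inductive_cases run_ConsE: "run A (s, \<tau>, U) ((a, d) # w) c"

lemma run_appendE:
  assumes "run A c (u @ v) c'"
  obtains c'' where "run A c u c''" "run A c'' v c'"
proof -
  have "\<exists>c''. run A c u c'' \<and> run A c'' v c'"
    using assms
  proof (induction u arbitrary: c)
    case Nil
    then show ?case using run_Nil[of A c] unfolding append_Nil by blast
  next
    case (Cons x u)
    obtain s \<tau> U where c: "c = (s, \<tau>, U)" by (cases c)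
    obtain a d where x: "x = (a, d)" by (cases x)
    from Cons.prems have "run A (s, \<tau>, U) ((a, d) # (u @ v)) c'"
      by (simp add: c x)
    then show ?case
      using Cons.IH unfolding c x by (elim run_ConsE) (meson run_Cons)
  qed
  then show ?thesis using that by blast
qed

lemma run_used:
  assumes "run A c w c'"
  shows "snd (snd c') = snd (snd c) \<union> data w"
  using assms by induction auto

lemma run_dom:
  assumes "session_automaton A" "run A c w c'" "dom (fst (snd c)) \<subseteq> registers A"
  shows "dom (fst (snd c')) \<subseteq> registers A"
  using assms(2,3) by induction (auto dest: session_automatonD(3)[OF assms(1)])

lemma run_card_ran:
  assumes A: "session_automaton A" and "run A (initial A, Map.empty, {}) w (s, \<tau>, U)"
  shows "finite (ran \<tau>)" "card (ran \<tau>) \<le> card (registers A)"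
proof -
  have fin: "finite (registers A)"
    using A by (simp add: session_automaton_def)
  have sub: "dom \<tau> \<subseteq> registers A"
    using run_dom[OF assms] by simp
  have fin': "finite (dom \<tau>)"
    using finite_subset[OF sub fin] .
  have ran: "ran \<tau> = (the \<circ> \<tau>) ` dom \<tau>"
    by (force simp: ran_def dom_def)
  show "finite (ran \<tau>)"
    using fin' by (simp add: ran)
  have "card (ran \<tau>) \<le> card (dom \<tau>)"
    unfolding ran by (rule card_image_le[OF fin'])
  also have "\<dots> \<le> card (registers A)"
    by (rule card_mono[OF fin sub])
  finally show "card (ran \<tau>) \<le> card (registers A)" .
qed

text \<open>The next occurrence of a used value fails the freshness test, so some register must hold
  it at that moment. The letters read before it write only other values, so it was stored from the
  start.\<close>

lemma run_used_in_ran: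
  assumes "run A c w c'" "d \<in> snd (snd c)" "d \<in> data w"
  shows "d \<in> ran (fst (snd c))"
  using assms
proof induction
  case (run_Nil c)
  then show ?case by simp
next
  case (run_Cons s a \<pi> s' \<tau> U e w c)
  show ?case
  proof (cases "d = e")
    case True
    with run_Cons show ?thesis by (cases \<pi>) (auto intro: ranI)
  next
    case False
    with run_Cons have "d \<in> ran (\<tau>(reg \<pi> \<mapsto> e))" by (simp add: fun_upd_def)
    with False show ?thesis
      by (auto simp: ran_def split: if_splits)
  qed
qed

lemma language_bounded:
  assumes A: "session_automaton A" and w: "w \<in> language A"
  shows "bounded (card (registers A)) w"
  unfolding bounded_iff_split
proof (intro allI impI)
  fix u x v assume eq: "w = u @ x # v"
  from w obtain c where "run A (initial A, Map.empty, {}) ((u @ [x]) @ v) c"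
    unfolding language_def eq by auto
  then obtain c' where u: "run A (initial A, Map.empty, {}) (u @ [x]) c'" and v: "run A c' v c"
    by (rule run_appendE)
  obtain s \<tau> U where c': "c' = (s, \<tau>, U)" by (cases c')
  have U: "U = data (u @ [x])"
    using run_used[OF u] c' by simp
  \<comment> \<open>Either kind of action leaves the value just read in a register. This covers the
    current value even if it does not occur in \<open>v\<close>; every other open value occurs in
    \<open>v\<close> and has been used.\<close>
  have "snd x \<in> ran \<tau>"
  proof -
    from u obtain s0 \<tau>0 U0 where "run A (s0, \<tau>0, U0) [(fst x, snd x)] c'"
      by (metis run_appendE prod.collapse)
    then show ?thesis
      unfolding c' by (elim run_ConsE) (auto elim!: run_NilE simp: ran_def)
  qed
  then have "data (u @ [x]) \<inter> data (x # v) \<subseteq> ran \<tau>"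
    using run_used_in_ran[OF v] unfolding c' U by auto
  moreover note run_card_ran[OF A u[unfolded c']]
  ultimately show "card (data (u @ [x]) \<inter> data (x # v)) \<le> card (registers A)"
    by (meson card_mono order_trans)
qed

section \<open>The automaton of all bounded words\<close>

text \<open>With a single state, all nondeterminism lies in the choice of the register that receives
  a fresh value.\<close>

definition bounded_automaton :: "nat \<Rightarrow> (unit, nat, 'a) automaton" where
  "bounded_automaton k =
     \<lparr>states = UNIV, registers = {..<k}, initial = (), final = UNIV,
      transitions = UNIV \<times> (UNIV \<times> (Fresh ` {..<k} \<union> Reuse ` {..<k})) \<times> UNIV\<rparr>"

lemma session_automaton_bounded_automaton:
  "0 < k \<Longrightarrow> session_automaton (bounded_automaton k)"
  by (auto simp: session_automaton_def bounded_automaton_def)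

text \<open>The invariant asks registers to hold only those seen values that are still to come.
  Boundedness then always leaves a register that a fresh value may overwrite.\<close>

lemma run_bounded_automaton:
  assumes "bounded k (u @ v)" "\<forall>d \<in> data u \<inter> data v. \<exists>r < k. \<tau> r = Some d"
  shows "\<exists>c. run (bounded_automaton k) ((), \<tau>, data u) v c"
  using assms
proof (induction v arbitrary: u \<tau>)
  case Nil
  then show ?case by (auto intro: run_Nil)
next
  case (Cons x v)
  obtain a d where x: "x = (a, d)" by (cases x)
  \<comment> \<open>Both cases end alike: it remains to name an enabled action that preserves the
    invariant.\<close>
  have step: ?case
    if \<pi>: "\<pi> \<in> Fresh ` {..<k} \<union> Reuse ` {..<k}" "enabled \<tau> (data u) \<pi> d"
      and live: "\<forall>e \<in> data (u @ [x]) \<inter> data v. \<exists>r < k. (\<tau>(reg \<pi> \<mapsto> d)) r = Some e" for \<pi>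
  proof -
    obtain c where "run (bounded_automaton k) ((), \<tau>(reg \<pi> \<mapsto> d), data (u @ [x])) v c"
      using Cons.IH[of "u @ [x]", OF _ live] Cons.prems(1) by (auto simp: fun_upd_def)
    then have "run (bounded_automaton k) ((), \<tau>, data u) ((a, d) # v) c"
      using \<pi> by (intro run_Cons[where \<pi> = \<pi> and s' = "()"]) (auto simp: bounded_automaton_def x)
    then show ?thesis unfolding x by blast
  qed
  show ?case
  proof (cases "d \<in> data u")
    case True
    then obtain r where r: "r < k" "\<tau> r = Some d"
      using Cons.prems(2) by (auto simp: x)
    then have "\<tau>(r \<mapsto> d) = \<tau>" by auto
    with r show ?thesis
      using Cons.prems(2) True by (intro step[of "Reuse r"]) (auto simp: x)
  next
    case False
    let ?L = "data u \<inter> data v"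
    have "\<forall>e \<in> ?L. \<exists>r. r < k \<and> \<tau> r = Some e"
      using Cons.prems(2) by auto
    \<comment> \<open>\<open>g\<close> selects one register per live value; any register outside its
      image can be overwritten without loss.\<close>
    then obtain g where g: "\<And>e. e \<in> ?L \<Longrightarrow> g e < k \<and> \<tau> (g e) = Some e"
      by metis
    have "card (insert d ?L) \<le> card (data (u @ [x]) \<inter> data (x # v))"
      by (intro card_mono) (auto simp: x)
    also have "\<dots> \<le> k"
      using Cons.prems(1) unfolding bounded_iff_split by blast
    \<comment> \<open>The bound is strict because the session of \<open>d\<close> is open here,
      while \<open>d\<close>, being new, is not in \<open>?L\<close>.\<close>
    finally have "card ?L < k" using False by (simp add: card_insert_if)
    then have "card (g ` ?L) < card {..<k}"
      by (simp add: le_less_trans[OF card_image_le])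
    then have "\<not> {..<k} \<subseteq> g ` ?L"
      using card_mono[of "g ` ?L" "{..<k}"] by auto
    then obtain r where r: "r < k" "r \<notin> g ` ?L" by auto
    show ?thesis
    proof (rule step[of "Fresh r"])
      show "\<forall>e \<in> data (u @ [x]) \<inter> data v. \<exists>q < k. (\<tau>(reg (Fresh r) \<mapsto> d)) q = Some e"
      proof
        fix e assume e: "e \<in> data (u @ [x]) \<inter> data v"
        show "\<exists>q < k. (\<tau>(reg (Fresh r) \<mapsto> d)) q = Some e"
        proof (cases "e = d")
          case True
          with r show ?thesis by auto
        next
          case False
          with e have "e \<in> ?L" by (auto simp: x)
          with g[OF this] r show ?thesis by (intro exI[of _ "g e"]) auto
        qed
      qed
    qed (use r False in auto)
  qed
qed

lemma language_bounded_automaton: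
  assumes "0 < k"
  shows "language (bounded_automaton k) = {w :: ('a::finite, 'd) data_word. bounded k w}"
proof (intro equalityI subsetI)
  fix w :: "('a, 'd) data_word" assume "w \<in> language (bounded_automaton k)"
  from language_bounded[OF session_automaton_bounded_automaton[OF assms] this]
  show "w \<in> {w. bounded k w}" by (simp add: bounded_automaton_def)
next
  fix w :: "('a, 'd) data_word" assume "w \<in> {w. bounded k w}"
  then show "w \<in> language (bounded_automaton k)"
    using run_bounded_automaton[of k "[]" w Map.empty]
    by (auto simp: language_def bounded_automaton_def)
qed

lemma sa_recognizable_bounded:
  assumes "0 < k"
  shows "sa_recognizable {w :: ('a::finite, 'd) data_word. bounded k w}"
  using sa_recognizableI[OF session_automaton_bounded_automaton[OF assms]]
  unfolding language_bounded_automaton[OF assms] .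

section \<open>Data deterministic automata\<close>

text \<open>Since stored values are used values, membership of \<open>d\<close> in \<open>U\<close>
  decides between reuse and freshness. Injectivity of the assignment fixes the register of a reuse,
  data determinism that of a fresh action. Both invariants survive each step, as a fresh value is
  not stored yet.\<close>

lemma data_deterministic_run_unique:
  assumes A: "session_automaton A" "data_deterministic A"
    and "run A c w c1" "run A c w c2"
    and "inj_on (fst (snd c)) (dom (fst (snd c)))" "ran (fst (snd c)) \<subseteq> snd (snd c)"
  shows "c1 = c2"
  using assms(3-6)
proof (induction arbitrary: c2)
  case (run_Nil c)
  then show ?case by (auto elim: run_NilE)
next
  case (run_Cons s a \<pi> s' \<tau> U d w c)
  from run_Cons.prems(1) obtain \<rho> t where \<rho>: "(s, (a, \<rho>), t) \<in> transitions A" "enabled \<tau> U \<rho> d"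
    and run: "run A (t, \<tau>(reg \<rho> \<mapsto> d), insert d U) w c2"
    by (rule run_ConsE)
  have inj: "inj_on \<tau> (dom \<tau>)" and ran: "ran \<tau> \<subseteq> U"
    using run_Cons.prems by simp_all
  have same: "\<rho> = \<pi>"
  proof (cases "d \<in> U")
    case True
    then show ?thesis
      using \<rho>(2) run_Cons.hyps(2) inj by (cases \<rho>; cases \<pi>) (auto simp: inj_on_def dom_def)
  next
    case False
    with ran have "\<tau> r \<noteq> Some d" for r by (auto simp: ran_def)
    with \<rho>(2) run_Cons.hyps(2) obtain r q where "\<rho> = Fresh r" "\<pi> = Fresh q"
      by (cases \<rho>; cases \<pi>) auto
    with \<rho>(1) run_Cons.hyps(1) show ?thesis
      using A(2) session_automatonD[OF A(1) \<rho>(1)] session_automatonD[OF A(1) run_Cons.hyps(1)]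
      unfolding data_deterministic_def by (metis reg.simps(1))
  qed
  with \<rho>(1) run_Cons.hyps(1) A(2) have "t = s'"
    unfolding data_deterministic_def symbolically_deterministic_def by blast
  moreover have "inj_on (\<tau>(reg \<pi> \<mapsto> d)) (dom (\<tau>(reg \<pi> \<mapsto> d)))"
  proof (cases \<pi>)
    case (Fresh r)
    with run_Cons.hyps(2) ran have "\<tau> q \<noteq> Some d" for q by (auto simp: ran_def)
    with inj show ?thesis by (auto simp: inj_on_def Fresh)
  next
    case (Reuse r)
    with run_Cons.hyps(2) have "\<tau>(reg \<pi> \<mapsto> d) = \<tau>" by auto
    with inj show ?thesis by simp
  qed
  moreover have "ran (\<tau>(reg \<pi> \<mapsto> d)) \<subseteq> insert d U"
    using ran by (auto simp: ran_def)
  ultimately show ?case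
    using run_Cons.IH[of c2] run unfolding same fst_conv snd_conv by blast
qed

lemma not_dsa_recognizable_bounded_2:
  assumes "infinite (UNIV :: 'd set)"
  shows "\<not> dsa_recognizable {w :: ('a::finite, 'd) data_word. bounded 2 w}"
proof
  assume "dsa_recognizable {w :: ('a, 'd) data_word. bounded 2 w}"
  then obtain A :: "(nat, nat, 'a) automaton" where A: "session_automaton A" "data_deterministic A"
    and L: "language A = {w :: ('a, 'd) data_word. bounded 2 w}"
    unfolding dsa_recognizable_def by blast
  let ?c = "(initial A, Map.empty, {}) :: (nat, nat, 'd) config"
  \<comment> \<open>One value more than there are registers, so that they cannot all be stored at
    once.\<close>
  obtain D :: "'d set" where D: "finite D" "card D = Suc (card (registers A))"
    using infinite_arbitrarily_large[OF assms] by blast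
  obtain ds where ds: "set ds = D" "distinct ds"
    using finite_distinct_list[OF D(1)] by blast
  obtain a :: 'a where True by simp
  define w where "w = map (Pair a) ds"
  have w: "map snd w = ds" "data w = D"
    by (simp_all add: w_def ds image_image o_def)
  \<comment> \<open>The configuration reached after \<open>w\<close> may a priori depend on the
    repeated value \<open>d\<close>; uniqueness of runs identifies all of them with one
    \<open>c\<close>.\<close>
  have ext: "\<exists>c c'. run A ?c w c \<and> run A c [(a, d)] c'" for d
  proof -
    have "w @ [(a, d)] \<in> language A"
      using bounded_2_repeat[of w a d] ds w by (simp add: L)
    then show ?thesis
      unfolding language_def by (blast elim: run_appendE)
  qed
  then obtain c where c: "run A ?c w c" by blast
  obtain s \<tau> U where c_eq: "c = (s, \<tau>, U)" by (cases c)
  have "D \<subseteq> ran \<tau>"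
  proof
    fix d assume d: "d \<in> D"
    from ext[of d] obtain c1 c' where c1: "run A ?c w c1" "run A c1 [(a, d)] c'" by blast
    have "c1 = c"
      using data_deterministic_run_unique[OF A c1(1) c] by simp
    with run_used_in_ran[OF c1(2), of d] run_used[OF c] d w show "d \<in> ran \<tau>"
      by (simp add: c_eq)
  qed
  with run_card_ran[OF A(1) c[unfolded c_eq]] D(2) show False
    using card_mono[of "ran \<tau>" D] by simp
qed

theorem theorem3p5:
  assumes "infinite (UNIV :: 'd set)"
  shows "(\<forall>L :: ('a::finite, 'd) data_language. dsa_recognizable L \<longrightarrow> sa_recognizable L) \<and>
    sa_recognizable {w :: ('a, 'd) data_word. bounded 2 w} \<and>
    \<not> dsa_recognizable {w :: ('a, 'd) data_word. bounded 2 w} \<and>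
    {L :: ('a, 'd) data_language. dsa_recognizable L} \<subset> {L. sa_recognizable L}"
proof -
  have sub: "sa_recognizable L" if "dsa_recognizable L" for L :: "('a, 'd) data_language"
    using that unfolding dsa_recognizable_def sa_recognizable_def by blast
  moreover have "sa_recognizable {w :: ('a, 'd) data_word. bounded 2 w}"
    by (rule sa_recognizable_bounded) simp
  moreover note not_dsa_recognizable_bounded_2[OF assms, where 'a = 'a]
  ultimately show ?thesis by blast
qed

end
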